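(* Fix an integer $k\geq1$. Let $C_k(r)=\mathrm{AO}(K_{k,\ldots,k})$, where there are $r$ parts, each of size $k$. Then, as $r\to\infty$, $$C_k(r)=e^{-(k-1)/2}(kr)!\left(1-\frac{(k-1)(5k-7)}{24kr}+O(r^{-2})\right).$$
   Context: $\mathrm{AO}(G)$ is the number of acyclic orientations of $G$; $K_{k,\ldots,k}$ is the complete multipartite graph with all parts of size $k$. The implicit constant may depend on the fixed $k$. *)

theory Defs
  imports Complex_Main "HOL-Library.Landau_Symbols"
begin

text \<open>An undirected graph is a pair \<open>(V, E)\<close>, where edges are two-element subsets of \<open>V\<close>.\<close>

type_synonym 'v graph = "'v set \<times> 'v set set"

definition finite_simple_graph :: "'v graph \<Rightarrow> bool" where
  "finite_simple_graph G \<longleftrightarrow> finite (fst G) \<and> (\<forall>e\<in>snd G. e \<subseteq> fst G \<and> card e = 2)"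

text \<open>
  An orientation is given by its set of arcs; it contains exactly one of the two arcs
  \<open>(u, v)\<close> and \<open>(v, u)\<close> for each edge \<open>{u, v}\<close>, and no other arcs.
\<close>

definition orientation :: "'v graph \<Rightarrow> ('v \<times> 'v) set \<Rightarrow> bool" where
  "orientation G A \<longleftrightarrow>
     (\<forall>(u, v)\<in>A. {u, v} \<in> snd G) \<and>
     (\<forall>u v. {u, v} \<in> snd G \<longrightarrow> ((u, v) \<in> A \<longleftrightarrow> (v, u) \<notin> A))"

definition AO :: "'v graph \<Rightarrow> nat" where
  "AO G = card {A. orientation G A \<and> acyclic A}"

text \<open>The vertex \<open>(i, a)\<close> is the \<open>a\<close>-th vertex of the \<open>i\<close>-th part, which has size \<open>s i\<close>.\<close>

definition complete_multipartite :: "nat \<Rightarrow> (nat \<Rightarrow> nat) \<Rightarrow> (nat \<times> nat) graph" where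
  "complete_multipartite r s =
     (let V = (SIGMA i:{..<r}. {..<s i})
      in (V, {{u, v} | u v. u \<in> V \<and> v \<in> V \<and> fst u \<noteq> fst v}))"

lemma finite_simple_graph_complete_multipartite:
  "finite_simple_graph (complete_multipartite r s)"
  by (auto simp: finite_simple_graph_def complete_multipartite_def Let_def card_2_iff)

end

theory Submission
  imports Defs "HOL-Computational_Algebra.Polynomial"
begin

text \<open>
  Summing \<open>(-1)\<^sup>|\<^sup>S\<^sup>|\<close> over the pairs of an acyclic orientation and a set \<open>S\<close> of its sources gives
  \<open>\<Sum>\<^sub>S (-1)\<^sup>|\<^sup>S\<^sup>| AO (G - S) = 0\<close>, summed over independent \<open>S\<close>. For complete multipartite graphs this recurrence
  is solved by \<open>L (\<Prod>\<^sub>i P\<^bsub>s i\<^esub>)\<close>, where \<open>L\<close> is the linear functional \<open>t\<^sup>m \<mapsto> m!\<close>, which satisfies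
  \<open>L p = p 0 + L p'\<close>, and \<open>P\<^sub>s\<close> is the Touchard polynomial with signs, \<open>P\<^sub>s t = (-1)\<^sup>s B\<^sub>s (-t)\<close>.
  Hence \<open>C\<^sub>k r = L (P\<^sub>k ^ r)\<close>.

  Reversing the coefficients, \<open>P\<^sub>k\<close> becomes \<open>1 + y U y\<close>, and
  \<open>C\<^sub>k r / n! = \<Sum>\<^sub>j (r choose j) \<Sum>\<^sub>i [y\<^sup>i] (U y)\<^sup>j * (n - j - i)! / n!\<close> with \<open>n = k r\<close>. The terms with \<open>i \<ge> 2\<close> sum to
  \<open>O(r\<^sup>-\<^sup>2)\<close>; those with \<open>i \<le> 1\<close> are expanded in \<open>1/r\<close> with an error dominated, for each \<open>j\<close>, by
  \<open>r\<^sup>-\<^sup>2\<close> times the \<open>j\<close>-th term of an exponential series, and the leading parts sum to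
  polynomials in \<open>c = (k - 1)/2\<close> times \<open>exp (- c)\<close>.
\<close>

subsection \<open>Sources of acyclic orientations\<close>

definition sources :: "'v graph \<Rightarrow> ('v \<times> 'v) set \<Rightarrow> 'v set" where
  "sources G A = {v \<in> fst G. \<forall>u. (u, v) \<notin> A}"

definition remove_vertices :: "'v graph \<Rightarrow> 'v set \<Rightarrow> 'v graph" where
  "remove_vertices G S = (fst G - S, {e \<in> snd G. e \<inter> S = {}})"

definition independent_set :: "'v graph \<Rightarrow> 'v set \<Rightarrow> bool" where
  "independent_set G S \<longleftrightarrow> (\<forall>u\<in>S. \<forall>v\<in>S. {u, v} \<notin> snd G)"

lemma sum_alternating_subsets:
  assumes "finite X" "X \<noteq> {}"
  shows "(\<Sum>S\<in>Pow X. (-1) ^ card S) = (0 :: int)"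
proof -
  have "(0 :: int) = (\<Prod>x\<in>X. -1 + 1)"
    using assms by (simp add: card_gt_0_iff)
  also have "\<dots> = (\<Sum>S\<in>Pow X. (\<Prod>x\<in>S. -1) * (\<Prod>x\<in>X - S. 1))"
    by (rule prod_add[OF assms(1)])
  finally show ?thesis by simp
qed

lemma orientation_iff:
  assumes "orientation G A" "{u, v} \<in> snd G"
  shows "(u, v) \<in> A \<longleftrightarrow> (v, u) \<notin> A"
  using assms unfolding orientation_def by blast

lemma orientation_edge:
  assumes "orientation G A" "(u, v) \<in> A"
  shows "{u, v} \<in> snd G"
  using assms unfolding orientation_def by blast

lemma orientation_subset:
  assumes "finite_simple_graph G" "orientation G A"
  shows "A \<subseteq> fst G \<times> fst G"
proof clarify
  fix u v assume "(u, v) \<in> A"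
  then have "{u, v} \<in> snd G" using orientation_edge[OF assms(2)] by blast
  then show "u \<in> fst G \<and> v \<in> fst G" using assms(1) by (auto simp: finite_simple_graph_def)
qed

lemma finite_orientations:
  assumes "finite_simple_graph G"
  shows "finite {A. orientation G A \<and> acyclic A}"
proof (rule finite_subset)
  show "{A. orientation G A \<and> acyclic A} \<subseteq> Pow (fst G \<times> fst G)"
    using orientation_subset[OF assms] by auto
  show "finite (Pow (fst G \<times> fst G))"
    using assms by (simp add: finite_simple_graph_def)
qed

text \<open>A finite acyclic relation is well-founded, and a minimal vertex has no incoming
  arc.\<close>

lemma sources_nonempty:
  assumes G: "finite_simple_graph G" and A: "orientation G A" "acyclic A" and V: "fst G \<noteq> {}"
  shows "sources G A \<noteq> {}"
proof -
  have sub: "A \<subseteq> fst G \<times> fst G" by (rule orientation_subset[OF G A(1)])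
  have "finite A" using sub G finite_subset by (fastforce simp: finite_simple_graph_def)
  then have "wf A" using A(2) by (rule finite_acyclic_wf)
  moreover obtain x where "x \<in> fst G" using V by blast
  ultimately obtain z where "z \<in> fst G" "\<And>y. (y, z) \<in> A \<Longrightarrow> y \<notin> fst G"
    by (rule wfE_min) blast
  then have "z \<in> sources G A" using sub by (auto simp: sources_def)
  then show ?thesis by blast
qed

text \<open>No arc of \<open>A\<close> or \<open>B\<close> ends in \<open>S\<close>, so a path that
  starts outside \<open>S\<close> uses arcs of \<open>A\<close> only. A closed path ends, hence also
  starts, outside \<open>S\<close>, and would be a cycle of \<open>A\<close>.\<close>

lemma acyclic_add_sources:
  assumes "acyclic A" "\<And>x y. (x, y) \<in> A \<Longrightarrow> x \<notin> S \<and> y \<notin> S"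
    and "\<And>x y. (x, y) \<in> B \<Longrightarrow> x \<in> S \<and> y \<notin> S"
  shows "acyclic (A \<union> B)"
proof (rule acyclicI, clarify)
  fix x assume "(x, x) \<in> (A \<union> B)\<^sup>+"
  moreover have "y \<notin> S \<and> (x \<in> S \<or> (x, y) \<in> A\<^sup>+)" if "(x, y) \<in> (A \<union> B)\<^sup>+" for x y
    using that
  proof (induction rule: trancl_induct)
    case (base y)
    then show ?case using assms(2,3) by blast
  next
    case (step y z)
    then show ?case using assms(2,3) by (metis Un_iff trancl.trancl_into_trancl)
  qed
  ultimately have "(x, x) \<in> A\<^sup>+" by blast
  then show False using assms(1) by (simp add: acyclic_def)
qed

text \<open>Once all vertices of \<open>S\<close> are sources, every arc at \<open>S\<close> is
  forced to point away from \<open>S\<close>. Adding or deleting these forced arcs, the set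
  \<open>B\<close> below, gives the bijection. Independence of \<open>S\<close> ensures that
  \<open>B\<close> never enters \<open>S\<close>.\<close>

lemma card_orientations_with_sources:
  assumes G: "finite_simple_graph G" and S: "S \<subseteq> fst G" "independent_set G S"
  shows "card {A. orientation G A \<and> acyclic A \<and> S \<subseteq> sources G A} = AO (remove_vertices G S)"
proof -
  define B where "B = {(u, v). u \<in> S \<and> {u, v} \<in> snd G}"
  have B: "x \<in> S \<and> y \<notin> S" if "(x, y) \<in> B" for x y
    using that S(2) by (auto simp: B_def independent_set_def)
  have out: "x \<notin> S \<and> y \<notin> S" if "orientation (remove_vertices G S) A" "(x, y) \<in> A" for A x y
    using orientation_edge[OF that] by (auto simp: remove_vertices_def)
  have "bij_betw (\<lambda>A. A \<union> B) {A. orientation (remove_vertices G S) A \<and> acyclic A}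
          {A. orientation G A \<and> acyclic A \<and> S \<subseteq> sources G A}"
  proof (rule bij_betw_byWitness[where f' = "\<lambda>A. A - B"]; (intro ballI)?)
    fix A assume "A \<in> {A. orientation (remove_vertices G S) A \<and> acyclic A}"
    then have A: "orientation (remove_vertices G S) A" by simp
    have "A \<inter> B = {}"
    proof (rule equals0I)
      fix e assume e: "e \<in> A \<inter> B"
      obtain x y where "e = (x, y)" by (rule prod.exhaust)
      then show False using e out[OF A, of x y] B[of x y] by simp
    qed
    then show "A \<union> B - B = A" by blast
  next
    fix A assume "A \<in> {A. orientation G A \<and> acyclic A \<and> S \<subseteq> sources G A}"
    then have A: "orientation G A" "S \<subseteq> sources G A" by auto
    have "B \<subseteq> A"
    proof clarify
      fix u v assume "(u, v) \<in> B"
      then have "u \<in> S" "{u, v} \<in> snd G" by (auto simp: B_def)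
      moreover have "(v, u) \<notin> A" using A(2) \<open>u \<in> S\<close> by (auto simp: sources_def)
      ultimately show "(u, v) \<in> A" using orientation_iff[OF A(1)] by blast
    qed
    then show "A - B \<union> B = A" by blast
  next
    show "(\<lambda>A. A \<union> B) ` {A. orientation (remove_vertices G S) A \<and> acyclic A}
      \<subseteq> {A. orientation G A \<and> acyclic A \<and> S \<subseteq> sources G A}"
    proof (rule image_subsetI, rule CollectI, intro conjI)
      fix A assume "A \<in> {A. orientation (remove_vertices G S) A \<and> acyclic A}"
      then have A: "orientation (remove_vertices G S) A" "acyclic A" by auto
      show "acyclic (A \<union> B)"
        using acyclic_add_sources[OF A(2)] out[OF A(1)] B by blast
      show "S \<subseteq> sources G (A \<union> B)"
        using S(1) out[OF A(1)] B by (auto simp: sources_def)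
      show "orientation G (A \<union> B)"
        unfolding orientation_def
      proof (intro conjI allI impI)
        show "\<forall>(u, v)\<in>A \<union> B. {u, v} \<in> snd G"
          using orientation_edge[OF A(1)] by (auto simp: remove_vertices_def B_def)
      next
        fix u v assume e: "{u, v} \<in> snd G"
        show "((u, v) \<in> A \<union> B) = ((v, u) \<notin> A \<union> B)"
        proof (cases "u \<in> S \<or> v \<in> S")
          case True
          then have "(u, v) \<notin> A" "(v, u) \<notin> A" using out[OF A(1)] by blast+
          moreover have "u \<notin> S \<or> v \<notin> S" using e S(2) by (auto simp: independent_set_def)
          ultimately show ?thesis using True e by (auto simp: B_def insert_commute)
        next
          case False
          then have "(u, v) \<notin> B" "(v, u) \<notin> B" using B by blast+
          moreover have "{u, v} \<in> snd (remove_vertices G S)"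
            using False e by (simp add: remove_vertices_def)
          ultimately show ?thesis using orientation_iff[OF A(1)] by blast
        qed
      qed
    qed
  next
    show "(\<lambda>A. A - B) ` {A. orientation G A \<and> acyclic A \<and> S \<subseteq> sources G A}
      \<subseteq> {A. orientation (remove_vertices G S) A \<and> acyclic A}"
    proof (rule image_subsetI, rule CollectI, intro conjI)
      fix A assume "A \<in> {A. orientation G A \<and> acyclic A \<and> S \<subseteq> sources G A}"
      then have A: "orientation G A" "acyclic A" "S \<subseteq> sources G A" by auto
      show "acyclic (A - B)" using A(2) by (rule acyclic_subset) blast
      show "orientation (remove_vertices G S) (A - B)"
        unfolding orientation_def
      proof (intro conjI allI impI)
        have "{u, v} \<in> snd (remove_vertices G S)" if "(u, v) \<in> A - B" for u v
        proof -
          have e: "{u, v} \<in> snd G" using orientation_edge[OF A(1)] that by blast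
          have "v \<notin> S" using A(3) that by (auto simp: sources_def)
          moreover have "u \<notin> S" using e that by (auto simp: B_def)
          ultimately show ?thesis using e by (simp add: remove_vertices_def)
        qed
        then show "\<forall>(u, v)\<in>A - B. {u, v} \<in> snd (remove_vertices G S)" by blast
      next
        fix u v assume e: "{u, v} \<in> snd (remove_vertices G S)"
        then have "u \<notin> S" "v \<notin> S" "{u, v} \<in> snd G" by (auto simp: remove_vertices_def)
        then show "((u, v) \<in> A - B) = ((v, u) \<notin> A - B)"
          using orientation_iff[OF A(1), of u v] B by blast
      qed
    qed
  qed
  then show ?thesis unfolding AO_def by (rule bij_betw_same_card[symmetric])
qed

lemma sources_independent:
  assumes "orientation G A" "S \<subseteq> sources G A"
  shows "independent_set G S"
  using assms unfolding independent_set_def orientation_def sources_def by blast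

lemma alternating_sum_AO:
  assumes G: "finite_simple_graph G" and V: "fst G \<noteq> {}"
  shows "(\<Sum>S | S \<subseteq> fst G \<and> independent_set G S. (-1) ^ card S * int (AO (remove_vertices G S))) = 0"
proof -
  let ?\<A> = "{A. orientation G A \<and> acyclic A}"
  have fV: "finite (fst G)" using G by (simp add: finite_simple_graph_def)
  have fA: "finite ?\<A>" by (rule finite_orientations[OF G])
  have "(\<Sum>S | S \<subseteq> fst G \<and> independent_set G S. (-1) ^ card S * int (AO (remove_vertices G S)))
      = (\<Sum>S | S \<subseteq> fst G \<and> independent_set G S. \<Sum>A | A \<in> ?\<A> \<and> S \<subseteq> sources G A. (-1) ^ card S)"
    by (rule sum.cong) (use G in \<open>simp_all flip: card_orientations_with_sources add: conj_assoc\<close>)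
  also have "\<dots> = (\<Sum>S\<in>Pow (fst G). \<Sum>A | A \<in> ?\<A> \<and> S \<subseteq> sources G A. (-1) ^ card S)"
  proof (rule sum.mono_neutral_left)
    show "\<forall>S\<in>Pow (fst G) - {S. S \<subseteq> fst G \<and> independent_set G S}.
      (\<Sum>A | A \<in> ?\<A> \<and> S \<subseteq> sources G A. (-1) ^ card S) = (0 :: int)"
      using sources_independent by (intro ballI sum.neutral) blast
  qed (use fV in auto)
  also have "\<dots> = (\<Sum>A\<in>?\<A>. \<Sum>S | S \<in> Pow (fst G) \<and> S \<subseteq> sources G A. (-1) ^ card S)"
    using fV fA by (intro sum.swap_restrict) auto
  also have "\<dots> = (\<Sum>A\<in>?\<A>. \<Sum>S\<in>Pow (sources G A). (-1) ^ card S)"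
    by (intro sum.cong) (auto simp: sources_def)
  also have "\<dots> = 0"
  proof (rule sum.neutral, clarify)
    fix A assume "orientation G A" "acyclic A"
    then have "sources G A \<noteq> {}" using sources_nonempty[OF G _ _ V] by blast
    moreover have "finite (sources G A)" using fV by (simp add: sources_def)
    ultimately show "(\<Sum>S\<in>Pow (sources G A). (-1) ^ card S) = (0 :: int)"
      by (rule sum_alternating_subsets[rotated])
  qed
  finally show ?thesis .
qed

subsection \<open>Acyclic orientations of complete multipartite graphs\<close>

text \<open>The coefficient of \<open>t\<^sup>j\<close> is \<open>(-1)\<^sup>n\<^sup>-\<^sup>j\<close> times the Stirling number of the second kind.\<close>

fun signed_touchard :: "nat \<Rightarrow> real poly" where
  "signed_touchard 0 = 1"
| "signed_touchard (Suc n) = pCons 0 (signed_touchard n - pderiv (signed_touchard n))"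

section \<open>The linear functional sending the m-th power of t to m!\<close>

definition factorial_functional :: "real poly \<Rightarrow> real" where
  "factorial_functional p = (\<Sum>i\<le>degree p. coeff p i * fact i)"

lemma factorial_functional_bound:
  assumes "degree p \<le> n"
  shows "factorial_functional p = (\<Sum>i\<le>n. coeff p i * fact i)"
  unfolding factorial_functional_def
  by (rule sum.mono_neutral_left) (use assms in \<open>auto simp: coeff_eq_0\<close>)

lemma factorial_functional_add:
  "factorial_functional (p + q) = factorial_functional p + factorial_functional q"
proof -
  define n where "n = max (degree p) (degree q)"
  have "degree p \<le> n" "degree q \<le> n" "degree (p + q) \<le> n"
    by (auto simp: n_def degree_add_le_max)
  then show ?thesis
    by (simp add: factorial_functional_bound[of _ n] sum.distrib ring_distribs)
qed

lemma factorial_functional_smult: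
  "factorial_functional (smult c p) = c * factorial_functional p"
  by (simp add: factorial_functional_bound[of "smult c p" "degree p"] degree_smult_le
      factorial_functional_def sum_distrib_left mult.assoc)

lemma factorial_functional_0: "factorial_functional 0 = 0"
  by (simp add: factorial_functional_def)

lemma factorial_functional_1: "factorial_functional 1 = 1"
  by (simp add: factorial_functional_def)

lemma factorial_functional_sum:
  "factorial_functional (\<Sum>x\<in>X. f x) = (\<Sum>x\<in>X. factorial_functional (f x))"
  by (induction X rule: infinite_finite_induct)
    (simp_all add: factorial_functional_0 factorial_functional_add)

text \<open>This is integration by parts: the functional is the integral of p(t) exp(-t) over t from
  0 to infinity. On coefficients it amounts to (i + 1) * i! = (i + 1)!.\<close>

lemma factorial_functional_pderiv:
  "factorial_functional p = coeff p 0 + factorial_functional (pderiv p)"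
proof -
  have "factorial_functional p = (\<Sum>i\<le>Suc (degree p). coeff p i * fact i)"
    by (rule factorial_functional_bound) simp
  also have "\<dots> = coeff p 0 + (\<Sum>i\<le>degree p. coeff (pderiv p) i * fact i)"
    by (subst sum.atMost_Suc_shift) (simp add: coeff_pderiv algebra_simps)
  also have "(\<Sum>i\<le>degree p. coeff (pderiv p) i * fact i) = factorial_functional (pderiv p)"
    by (rule factorial_functional_bound[symmetric]) (simp add: degree_pderiv)
  finally show ?thesis .
qed

section \<open>Alternating subset sums of signed Touchard polynomials\<close>

lemma sum_Pow_insert:
  assumes "finite Y" "x \<notin> Y"
  shows "(\<Sum>S\<in>Pow (insert x Y). f S) = (\<Sum>S\<in>Pow Y. f S) + (\<Sum>S\<in>Pow Y. f (insert x S))"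
proof -
  have "(\<Sum>S\<in>Pow (insert x Y). f S) = (\<Sum>S\<in>Pow Y. f S) + (\<Sum>S\<in>insert x ` Pow Y. f S)"
    unfolding Pow_insert using assms by (intro sum.union_disjoint) auto
  also have "(\<Sum>S\<in>insert x ` Pow Y. f S) = (\<Sum>S\<in>Pow Y. f (insert x S))"
    using assms by (subst sum.reindex) (auto simp: inj_on_def)
  finally show ?thesis .
qed

text \<open>In terms of the exponential generating function exp(t (1 - exp(-x))), both sides amount
  to multiplying it by exp(-x). The proof is by induction on the set: with \<open>?D\<close> the
  operator of the recursion and \<open>?q\<close> the value for \<open>Y\<close>, the subsets
  without the new element contribute \<open>?D ?q\<close> and those with it contribute
  \<open>- ?q\<close>. The product rule for t times \<open>?q\<close> identifies the total.\<close>

lemma signed_touchard_sum_subsets: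
  assumes "finite X"
  shows "(\<Sum>S\<in>Pow X. smult ((-1) ^ card S) (signed_touchard (card (X - S))))
       = signed_touchard (card X) - pderiv (signed_touchard (card X))"
  using assms
proof (induction X rule: finite_induct)
  case empty
  then show ?case by simp
next
  case (insert x Y)
  let ?D = "\<lambda>p :: real poly. pCons 0 (p - pderiv p)"
  let ?q = "signed_touchard (card Y) - pderiv (signed_touchard (card Y))"
  let ?f = "\<lambda>S. smult ((-1) ^ card S) (signed_touchard (card (Y - S)))"
  have add: "?D (p + q) = ?D p + ?D q" for p q
    by (simp add: pderiv_add)
  have D: "?D (\<Sum>S\<in>Z. g S) = (\<Sum>S\<in>Z. ?D (g S))" for g and Z :: "'a set set"
  proof (induction Z rule: infinite_finite_induct)
    case (insert S Z)
    show ?case unfolding sum.insert[OF insert.hyps] add insert.IH ..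
  qed simp_all
  have "(\<Sum>S\<in>Pow Y. smult ((-1) ^ card S) (signed_touchard (card (insert x Y - S)))) = (\<Sum>S\<in>Pow Y. ?D (?f S))"
  proof (rule sum.cong)
    fix S assume S: "S \<in> Pow Y"
    then have "insert x Y - S = insert x (Y - S)" using insert.hyps by blast
    then have "card (insert x Y - S) = Suc (card (Y - S))" using insert.hyps by simp
    then show "smult ((-1) ^ card S) (signed_touchard (card (insert x Y - S))) = ?D (?f S)"
      by (simp add: pderiv_smult smult_diff_right)
  qed simp
  also have "\<dots> = ?D ?q"
    by (simp only: D[symmetric] insert.IH)
  finally have 1: "(\<Sum>S\<in>Pow Y. smult ((-1) ^ card S) (signed_touchard (card (insert x Y - S)))) = ?D ?q" .
  have "(\<Sum>S\<in>Pow Y. smult ((-1) ^ card (insert x S)) (signed_touchard (card (insert x Y - insert x S))))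
      = (\<Sum>S\<in>Pow Y. - ?f S)"
  proof (rule sum.cong)
    fix S assume S: "S \<in> Pow Y"
    then have "insert x Y - insert x S = Y - S" "x \<notin> S" "finite S"
      using insert.hyps finite_subset by auto
    then show "smult ((-1) ^ card (insert x S)) (signed_touchard (card (insert x Y - insert x S))) = - ?f S"
      by simp
  qed simp
  also have "\<dots> = - ?q"
    by (simp only: sum_negf insert.IH)
  finally have 2: "(\<Sum>S\<in>Pow Y. smult ((-1) ^ card (insert x S)) (signed_touchard (card (insert x Y - insert x S)))) = - ?q" .
  show ?case
    unfolding sum_Pow_insert[OF insert.hyps(1,2)] 1 2
    using insert.hyps by (simp add: pderiv_pCons pderiv_diff algebra_simps)
qed

text \<open>The empty set accounts for the polynomial itself, which cancels. In this form a
  derivative encodes the deletion of a non-empty subset of one part.\<close>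

lemma pderiv_signed_touchard:
  assumes "finite X"
  shows "pderiv (signed_touchard (card X))
       = - (\<Sum>S\<in>Pow X - {{}}. smult ((-1) ^ card S) (signed_touchard (card (X - S))))"
  using signed_touchard_sum_subsets[OF assms] assms
  by (subst (asm) sum.remove[of _ "{}"]) (auto simp: algebra_simps eq_neg_iff_add_eq_0)

section \<open>The recurrence for complete multipartite graphs\<close>

definition multipartite :: "('i \<times> 'a) set \<Rightarrow> ('i \<times> 'a) graph" where
  "multipartite V = (V, {{u, v} | u v. u \<in> V \<and> v \<in> V \<and> fst u \<noteq> fst v})"

lemma finite_simple_graph_multipartite:
  "finite V \<Longrightarrow> finite_simple_graph (multipartite V)"
  by (auto simp: finite_simple_graph_def multipartite_def card_2_iff)

lemma edge_multipartite:
  "{u, v} \<in> snd (multipartite V) \<longleftrightarrow> u \<in> V \<and> v \<in> V \<and> fst u \<noteq> fst v"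
  by (auto simp: multipartite_def doubleton_eq_iff simp del: split_paired_Ex)

text \<open>Closure under deletion is the reason to allow an arbitrary set of pairs as vertex set,
  with the first coordinate naming the part: the recurrence then stays inside one family.\<close>

lemma remove_vertices_multipartite:
  "remove_vertices (multipartite V) S = multipartite (V - S)"
  by (fastforce simp: remove_vertices_def multipartite_def)

lemma AO_multipartite_empty: "AO (multipartite ({} :: ('i \<times> 'a) set)) = 1"
proof -
  have "{A. orientation (multipartite ({} :: ('i \<times> 'a) set)) A \<and> acyclic A} = {{}}"
    by (auto simp: orientation_def multipartite_def acyclic_def)
  then show ?thesis unfolding AO_def by simp
qed

text \<open>Vertices of different parts are adjacent, so a non-empty independent set lies in exactly
  one part and is determined by that part and a non-empty subset of it.\<close>

lemma bij_betw_independent_multipartite: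
  assumes "fst ` V \<subseteq> I"
  shows "bij_betw (\<lambda>(i, X). {i} \<times> X) (SIGMA i:I. Pow (V `` {i}) - {{}})
           ({S. S \<subseteq> V \<and> independent_set (multipartite V) S} - {{}})"
  unfolding bij_betw_def
proof (intro conjI)
  show "inj_on (\<lambda>(i, X). {i} \<times> X) (SIGMA i:I. Pow (V `` {i}) - {{}})"
    by (auto simp: inj_on_def times_eq_iff)
  show "(\<lambda>(i, X). {i} \<times> X) ` (SIGMA i:I. Pow (V `` {i}) - {{}})
      = {S. S \<subseteq> V \<and> independent_set (multipartite V) S} - {{}}"
  proof (intro equalityI subsetI)
    fix S assume "S \<in> {S. S \<subseteq> V \<and> independent_set (multipartite V) S} - {{}}"
    then have S: "S \<subseteq> V" "independent_set (multipartite V) S" "S \<noteq> {}" by auto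
    then obtain i a where ia: "(i, a) \<in> S" by auto
    have "fst u = i" if "u \<in> S" for u
      using S(1,2) ia that by (fastforce simp: independent_set_def edge_multipartite)
    then have "S = {i} \<times> (S `` {i})" by force
    moreover have "i \<in> I" using ia S(1) assms by force
    moreover have "S `` {i} \<in> Pow (V `` {i}) - {{}}" using ia S(1) by auto
    ultimately show "S \<in> (\<lambda>(i, X). {i} \<times> X) ` (SIGMA i:I. Pow (V `` {i}) - {{}})"
      by (intro image_eqI[of _ _ "(i, S `` {i})"]) auto
  qed (auto simp: independent_set_def edge_multipartite)
qed

lemma coeff_0_signed_touchard: "n > 0 \<Longrightarrow> coeff (signed_touchard n) 0 = 0"
  by (cases n) auto

text \<open>Strong induction on the vertex set. The index set \<open>I\<close> stays fixed while
  parts shrink; a part that has become empty contributes the factor 1.\<close>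

lemma AO_multipartite:
  assumes "finite V" "finite I" "fst ` V \<subseteq> I"
  shows "real (AO (multipartite V)) = factorial_functional (\<Prod>i\<in>I. signed_touchard (card (V `` {i})))"
  using assms(1,3)
proof (induction V rule: finite_psubset_induct)
  case (psubset V)
  show ?case
  proof (cases "V = {}")
    case True
    then show ?thesis by (simp add: AO_multipartite_empty factorial_functional_1)
  next
    case False
    let ?N = "{S. S \<subseteq> V \<and> independent_set (multipartite V) S}"
    let ?P = "\<lambda>i. signed_touchard (card (V `` {i}))"
    have fin: "finite ?N" using psubset.hyps by auto
    have finV: "finite (V `` {i})" for i
      using psubset.hyps by (simp add: finite_Image)
    have "(\<Sum>S\<in>?N. (-1) ^ card S * int (AO (multipartite (V - S)))) = 0"
      using alternating_sum_AO[OF finite_simple_graph_multipartite[OF psubset.hyps(1)]] False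
      by (simp add: remove_vertices_multipartite) (simp add: multipartite_def)
    then have "real_of_int (\<Sum>S\<in>?N. (-1) ^ card S * int (AO (multipartite (V - S)))) = 0"
      by simp
    then have "(\<Sum>S\<in>?N. (-1) ^ card S * real (AO (multipartite (V - S)))) = 0"
      by simp
    \<comment> \<open>The term of the empty set is the count for the whole graph; it is
      isolated.\<close>
    then have "real (AO (multipartite V))
        = - (\<Sum>S\<in>?N - {{}}. (-1) ^ card S * real (AO (multipartite (V - S))))"
      using fin by (subst (asm) sum.remove[of _ "{}"]) (auto simp: independent_set_def)
    also have "(\<Sum>S\<in>?N - {{}}. (-1) ^ card S * real (AO (multipartite (V - S))))
        = (\<Sum>(i, X)\<in>(SIGMA i:I. Pow (V `` {i}) - {{}}).
             (-1) ^ card X * real (AO (multipartite (V - {i} \<times> X))))"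
      by (subst sum.reindex_bij_betw[OF bij_betw_independent_multipartite[OF psubset.prems], symmetric])
        (auto simp: card_cartesian_product intro!: sum.cong)
    also have "\<dots> = (\<Sum>i\<in>I. \<Sum>X\<in>Pow (V `` {i}) - {{}}.
             (-1) ^ card X * real (AO (multipartite (V - {i} \<times> X))))"
      using assms(2) finV by (subst sum.Sigma) auto
    also have "\<dots> = (\<Sum>i\<in>I. \<Sum>X\<in>Pow (V `` {i}) - {{}}.
         factorial_functional (prod ?P (I - {i}) * smult ((-1) ^ card X) (signed_touchard (card (V `` {i} - X)))))"
    proof (intro sum.cong refl)
      fix i X assume i: "i \<in> I" and X: "X \<in> Pow (V `` {i}) - {{}}"
      have "V - {i} \<times> X \<subset> V" using X by auto
      then have "real (AO (multipartite (V - {i} \<times> X)))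
          = factorial_functional (\<Prod>j\<in>I. signed_touchard (card ((V - {i} \<times> X) `` {j})))"
        by (rule psubset.IH) (use psubset.prems in auto)
      also have "(\<Prod>j\<in>I. signed_touchard (card ((V - {i} \<times> X) `` {j})))
          = signed_touchard (card ((V - {i} \<times> X) `` {i})) * (\<Prod>j\<in>I - {i}. signed_touchard (card ((V - {i} \<times> X) `` {j})))"
        by (rule prod.remove[OF assms(2) i])
      also have "(V - {i} \<times> X) `` {i} = V `` {i} - X" by auto
      also have "(\<Prod>j\<in>I - {i}. signed_touchard (card ((V - {i} \<times> X) `` {j}))) = prod ?P (I - {i})"
      proof (rule prod.cong)
        fix j assume "j \<in> I - {i}"
        then have "(V - {i} \<times> X) `` {j} = V `` {j}" by auto
        then show "signed_touchard (card ((V - {i} \<times> X) `` {j})) = ?P j" by simp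
      qed simp
      finally show "(-1) ^ card X * real (AO (multipartite (V - {i} \<times> X))) = factorial_functional
          (prod ?P (I - {i}) * smult ((-1) ^ card X) (signed_touchard (card (V `` {i} - X))))"
        by (simp add: factorial_functional_smult mult.commute)
    qed
    \<comment> \<open>For each part the sum over its deleted subsets collapses to minus a
      derivative, so that the sum over the parts becomes the product rule.\<close>
    also have "\<dots> = (\<Sum>i\<in>I. factorial_functional (prod ?P (I - {i}) * - pderiv (?P i)))"
      by (simp add: pderiv_signed_touchard[OF finV] sum_distrib_left factorial_functional_sum)
    also have "- \<dots> = (\<Sum>i\<in>I. factorial_functional (prod ?P (I - {i}) * pderiv (?P i)))"
      using factorial_functional_smult[of "-1"] by (simp add: sum_negf)
    also have "\<dots> = factorial_functional (pderiv (prod ?P I))"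
      by (simp add: pderiv_prod factorial_functional_sum)
    \<comment> \<open>The product vanishes at 0 because some part is non-empty, so the boundary term
      of the integration by parts is 0.\<close>
    also have "\<dots> = factorial_functional (prod ?P I)"
    proof -
      obtain i a where "(i, a) \<in> V" using False by auto
      then have "card (V `` {i}) > 0" "i \<in> I"
        using finV psubset.prems by (auto simp: card_gt_0_iff)
      then have "\<exists>i\<in>I. poly (?P i) 0 = 0"
        using coeff_0_signed_touchard by (auto simp: poly_0_coeff_0)
      then have "poly (prod ?P I) 0 = 0" using assms(2) by (simp add: poly_prod)
      then have "coeff (prod ?P I) 0 = 0" by (simp add: poly_0_coeff_0)
      then show ?thesis using factorial_functional_pderiv[of "prod ?P I"] by simp
    qed
    finally show ?thesis .
  qed
qed

lemma AO_complete_multipartite: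
  "real (AO (complete_multipartite r (\<lambda>_. k))) = factorial_functional (signed_touchard k ^ r)"
proof -
  let ?V = "SIGMA i:{..<r}. {..<k}"
  have "complete_multipartite r (\<lambda>_. k) = multipartite ?V"
    by (simp add: complete_multipartite_def multipartite_def)
  then have "real (AO (complete_multipartite r (\<lambda>_. k)))
      = factorial_functional (\<Prod>i<r. signed_touchard (card (?V `` {i})))"
    by (simp add: AO_multipartite[of ?V "{..<r}"] fst_image_times)
  also have "(\<Prod>i<r. signed_touchard (card (?V `` {i}))) = (\<Prod>i<r. signed_touchard k)"
    by (rule prod.cong) (simp_all add: Image_def)
  finally show ?thesis by simp
qed

subsection \<open>Expansion in falling factorials\<close>

lemma coeff_signed_touchard_Suc:
  "coeff (signed_touchard (Suc n)) (Suc i) = coeff (signed_touchard n) i - real (Suc i) * coeff (signed_touchard n) (Suc i)"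
  by (simp add: coeff_pderiv)

lemma degree_signed_touchard_le: "degree (signed_touchard n) \<le> n"
proof (rule degree_le, intro allI impI)
  show "coeff (signed_touchard n) i = 0" if "n < i" for i
    using that
  proof (induction n arbitrary: i)
    case 0
    then show ?case by simp
  next
    case (Suc n)
    then obtain j where "i = Suc j" "n < j" by (cases i) auto
    then show ?case using Suc.IH by (simp add: coeff_pderiv)
  qed
qed

lemma coeff_signed_touchard_gt: "n < i \<Longrightarrow> coeff (signed_touchard n) i = 0"
  using degree_signed_touchard_le[of n] by (simp add: coeff_eq_0)

lemma coeff_signed_touchard_self: "coeff (signed_touchard n) n = 1"
  by (induction n) (simp_all add: coeff_pderiv coeff_signed_touchard_gt)

lemma degree_signed_touchard: "degree (signed_touchard n) = n"
  using degree_signed_touchard_le[of n] le_degree[of "signed_touchard n" n] by (simp add: coeff_signed_touchard_self)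

lemma coeff_signed_touchard_1: "coeff (signed_touchard (Suc n)) n = - real (Suc n) * real n / 2"
proof (induction n)
  case (Suc n)
  show ?case
    unfolding coeff_signed_touchard_Suc[of "Suc n" n] Suc.IH coeff_signed_touchard_self
    by (simp add: field_simps)
qed (simp add: coeff_0_signed_touchard del: signed_touchard.simps)

text \<open>The value is the Stirling number S(n+2, n) = binom(n+2, 3) + 3 binom(n+2, 4): either one
  block of size three or two blocks of size two.\<close>

lemma coeff_signed_touchard_2:
  "coeff (signed_touchard (Suc (Suc n))) n
     = real (Suc (Suc n)) * real (Suc n) * real n * (3 * real n + 1) / 24"
proof (induction n)
  case (Suc n)
  show ?case
    unfolding coeff_signed_touchard_Suc[of "Suc (Suc n)" n] Suc.IH coeff_signed_touchard_1
    by (simp add: field_simps)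
qed (simp add: coeff_0_signed_touchard del: signed_touchard.simps)

text \<open>The leading coefficient 1 becomes the constant term. The vanishing constant coefficient
  lowers the degree of the reflected polynomial to at most \<open>k - 1\<close>, which gives the
  bound \<open>k - 2\<close> for \<open>U\<close>; that bound later keeps the falling factorials
  away from their small factors.\<close>

lemma reflect_signed_touchard:
  assumes "k \<ge> 2"
  obtains U where "reflect_poly (signed_touchard k) = pCons 1 U" "degree U \<le> k - 2"
    "coeff U 0 = - (real k * (real k - 1) / 2)"
    "coeff U 1 = real k * (real k - 1) * (real k - 2) * (3 * real k - 5) / 24"
proof -
  obtain a U where U: "reflect_poly (signed_touchard k) = pCons a U" by (rule pCons_cases)
  have "a = coeff (reflect_poly (signed_touchard k)) 0" unfolding U by simp
  then have a: "a = 1" by (simp add: degree_signed_touchard coeff_signed_touchard_self)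
  have "coeff U i = coeff (reflect_poly (signed_touchard k)) (Suc i)" for i unfolding U by simp
  then have c: "coeff U i = (if i \<ge> k then 0 else coeff (signed_touchard k) (k - Suc i))" for i
    by (auto simp: coeff_reflect_poly degree_signed_touchard)
  obtain m where m: "k = Suc (Suc m)" using assms by (metis add_2_eq_Suc le_Suc_ex)
  have "coeff U i = 0" if "i > m" for i
    using that m by (cases "i = Suc m") (auto simp: c coeff_0_signed_touchard simp del: signed_touchard.simps)
  then have "degree U \<le> k - 2" by (intro degree_le) (auto simp: m)
  moreover have "coeff U 0 = - (real k * (real k - 1) / 2)"
    using coeff_signed_touchard_1[of "Suc m"] by (simp add: c m field_simps del: signed_touchard.simps)
  moreover have "coeff U 1 = real k * (real k - 1) * (real k - 2) * (3 * real k - 5) / 24"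
    using coeff_signed_touchard_2[of m] by (simp add: c m field_simps del: signed_touchard.simps)
  ultimately show ?thesis using that U a by blast
qed

text \<open>A submultiplicative norm: it bounds the coefficient sum of the j-th power of
  \<open>U\<close> by the j-th power of a constant.\<close>

definition poly_l1 :: "real poly \<Rightarrow> real" where
  "poly_l1 p = (\<Sum>i\<le>degree p. \<bar>coeff p i\<bar>)"

lemma poly_l1_bound:
  assumes "degree p \<le> n"
  shows "poly_l1 p = (\<Sum>i\<le>n. \<bar>coeff p i\<bar>)"
  unfolding poly_l1_def
  by (rule sum.mono_neutral_left) (use assms in \<open>auto simp: coeff_eq_0\<close>)

lemma poly_l1_nonneg: "poly_l1 p \<ge> 0"
  by (simp add: poly_l1_def sum_nonneg)

lemma poly_l1_pCons: "poly_l1 (pCons a p) = \<bar>a\<bar> + poly_l1 p"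
  by (subst poly_l1_bound[of _ "Suc (degree p)"])
    (simp_all add: sum.atMost_Suc_shift poly_l1_def degree_pCons_le del: sum.atMost_Suc)

lemma poly_l1_smult: "poly_l1 (smult a p) = \<bar>a\<bar> * poly_l1 p"
  by (simp add: poly_l1_bound[of "smult a p" "degree p"] degree_smult_le poly_l1_def
      sum_distrib_left abs_mult)

lemma poly_l1_add: "poly_l1 (p + q) \<le> poly_l1 p + poly_l1 q"
proof -
  define n where "n = max (degree p) (degree q)"
  have "degree p \<le> n" "degree q \<le> n" "degree (p + q) \<le> n"
    by (auto simp: n_def degree_add_le_max)
  then show ?thesis
    by (auto simp: poly_l1_bound[of _ n] simp flip: sum.distrib intro: sum_mono)
qed

lemma poly_l1_mult: "poly_l1 (p * q) \<le> poly_l1 p * poly_l1 q"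
proof (induction p)
  case (pCons a p)
  have "poly_l1 (pCons a p * q) \<le> \<bar>a\<bar> * poly_l1 q + poly_l1 (p * q)"
    using poly_l1_add[of "smult a q" "pCons 0 (p * q)"] by (simp add: poly_l1_smult poly_l1_pCons)
  then show ?case using pCons.IH by (simp add: poly_l1_pCons algebra_simps)
qed (simp add: poly_l1_def)

lemma poly_l1_power: "poly_l1 (p ^ n) \<le> poly_l1 p ^ n"
proof (induction n)
  case (Suc n)
  then show ?case
    using poly_l1_mult[of p "p ^ n"] mult_left_mono[OF Suc poly_l1_nonneg[of p]] by simp
qed (simp add: poly_l1_def)

section \<open>Binomial expansion of the r-th power under the functional\<close>

lemma coeff_pCons_1_power:
  fixes U :: "'a :: comm_ring_1 poly"
  shows "coeff (pCons 1 U ^ r) d = (\<Sum>j\<le>r. of_nat (r choose j) * (if j \<le> d then coeff (U ^ j) (d - j) else 0))"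
proof -
  have "pCons 1 U = monom 1 1 * U + 1"
    by (simp add: monom_altdef one_pCons)
  then have "pCons 1 U ^ r = (\<Sum>j\<le>r. of_nat (r choose j) * (monom 1 j * U ^ j))"
    by (simp add: binomial_ring power_mult_distrib monom_power)
  then show ?thesis
    by (auto simp: coeff_sum coeff_monom_mult of_nat_poly intro!: sum.cong)
qed

text \<open>For \<open>d \<le> n\<close> this is the reciprocal of the falling factorial n (n-1) ...
  (n-d+1).\<close>

definition inv_falling :: "nat \<Rightarrow> nat \<Rightarrow> real" where
  "inv_falling n d = fact (n - d) / fact n"

lemma factorial_functional_power:
  assumes P: "degree P = k" "reflect_poly P = pCons 1 U" and k: "k \<ge> 1"
  shows "factorial_functional (P ^ r) / fact (k * r)
       = (\<Sum>j\<le>r. real (r choose j) * (\<Sum>i\<le>k * r - j. coeff (U ^ j) i * inv_falling (k * r) (j + i)))"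
proof -
  let ?n = "k * r"
  have deg: "degree (P ^ r) = ?n"
    using P(1) by (cases "P = 0") (simp_all add: degree_power_eq power_0_left)
  have "factorial_functional (P ^ r) / fact ?n = (\<Sum>m\<le>?n. coeff (P ^ r) m * (fact m / fact ?n))"
    by (simp add: factorial_functional_def deg sum_divide_distrib)
  \<comment> \<open>Exponents are counted down from the top, which turns the coefficients into those
    of the reflected polynomial.\<close>
  also have "\<dots> = (\<Sum>d\<le>?n. coeff (P ^ r) (?n - d) * (fact (?n - d) / fact ?n))"
    by (rule sum.nat_diff_reindex[symmetric, where n = "Suc ?n", simplified lessThan_Suc_atMost diff_Suc_Suc])
  also have "\<dots> = (\<Sum>d\<le>?n. coeff (pCons 1 U ^ r) d * inv_falling ?n d)"
    by (rule sum.cong)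
      (simp_all add: inv_falling_def coeff_reflect_poly deg flip: P(2) reflect_poly_power)
  also have "\<dots> = (\<Sum>j\<le>r. real (r choose j) *
      (\<Sum>d\<le>?n. (if j \<le> d then coeff (U ^ j) (d - j) else 0) * inv_falling ?n d))"
    unfolding coeff_pCons_1_power sum_distrib_right sum_distrib_left
    by (subst sum.swap) (simp add: mult.assoc)
  also have "\<dots> = (\<Sum>j\<le>r. real (r choose j) * (\<Sum>i\<le>?n - j. coeff (U ^ j) i * inv_falling ?n (j + i)))"
  proof (rule sum.cong[OF refl], rule arg_cong[where f = "\<lambda>x. _ * x"])
    fix j assume "j \<in> {..r}"
    then have "j \<le> ?n" using k by (metis atMost_iff le_trans mult_le_mono1 nat_mult_1)
    have "(\<Sum>d\<le>?n. (if j \<le> d then coeff (U ^ j) (d - j) else 0) * inv_falling ?n d)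
        = (\<Sum>d\<in>{j..?n}. coeff (U ^ j) (d - j) * inv_falling ?n d)"
      by (rule sum.mono_neutral_cong_right) auto
    also have "\<dots> = (\<Sum>i\<le>?n - j. coeff (U ^ j) i * inv_falling ?n (j + i))"
      by (rule sum.reindex_bij_witness[of _ "\<lambda>i. i + j" "\<lambda>d. d - j"]) (use \<open>j \<le> ?n\<close> in auto)
    finally show "(\<Sum>d\<le>?n. (if j \<le> d then coeff (U ^ j) (d - j) else 0) * inv_falling ?n d)
        = (\<Sum>i\<le>?n - j. coeff (U ^ j) i * inv_falling ?n (j + i))" .
  qed
  finally show ?thesis .
qed

text \<open>Each of the \<open>d\<close> factors of the falling factorial is at least
  \<open>m\<close>.\<close>

lemma inv_falling_le:
  assumes "d \<le> n" "m \<le> n - d" "m > 0"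
  shows "inv_falling n d \<le> 1 / real m ^ d"
proof -
  have "fact (n - d) * real m ^ d \<le> fact n"
    using assms(1,2)
  proof (induction d)
    case (Suc d)
    then have nd: "n - d = Suc (n - Suc d)" by simp
    have "fact (n - Suc d) * real m ^ Suc d \<le> fact (n - Suc d) * (real (n - d) * real m ^ d)"
      using Suc.prems by (auto intro!: mult_right_mono)
    also have "\<dots> = fact (n - d) * real m ^ d" by (simp add: nd)
    also have "\<dots> \<le> fact n" using Suc by simp
    finally show ?case .
  qed simp
  then show ?thesis using assms(3) by (simp add: inv_falling_def field_simps)
qed

lemma inv_falling_nonneg: "inv_falling n d \<ge> 0"
  by (simp add: inv_falling_def)

lemma binomial_le_pow_div_fact: "real (r choose j) \<le> real r ^ j / fact j"
proof -
  have "real ((r choose j) * fact j) \<le> real (r ^ j)"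
    using binomial_fact_pow of_nat_le_iff by blast
  then show ?thesis by (simp add: field_simps)
qed

lemma sum_power_div_fact_le_exp:
  assumes "x \<ge> 0"
  shows "(\<Sum>j\<le>n. x ^ j / fact j) \<le> exp (x :: real)"
proof -
  have "(\<lambda>j. x ^ j / fact j) sums exp x"
    using exp_converges[of x] by (simp add: field_simps)
  then show ?thesis
    using assms sum_le_suminf[of "\<lambda>j. x ^ j / fact j" "{..n}"] by (auto simp: sums_iff)
qed

text \<open>Each index \<open>i \<ge> 2\<close> gains at least two further factors 1/r, and the
  coefficient norm controls the sum. The remaining r to the power -j will be cancelled by the
  binomial coefficient.\<close>

lemma higher_coefficients_bound:
  assumes U: "degree U \<le> k - 2" and k: "k \<ge> 2" and r: "r \<ge> 1" and j: "j \<le> r"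
  shows "\<bar>(\<Sum>i\<le>k * r - j. coeff (U ^ j) i * inv_falling (k * r) (j + i))
          - (coeff (U ^ j) 0 * inv_falling (k * r) j + coeff (U ^ j) 1 * inv_falling (k * r) (Suc j))\<bar>
       \<le> poly_l1 U ^ j / real r ^ (j + 2)"
proof -
  let ?n = "k * r"
  let ?f = "\<lambda>i. coeff (U ^ j) i * inv_falling ?n (j + i)"
  have kr: "?n = (k - 1) * r + r" using k by (cases k) auto
  have "1 * r \<le> (k - 1) * r" using k by (intro mult_right_mono) auto
  \<comment> \<open>This guarantees that both indices 0 and 1 occur in the sum from which they are
    split off.\<close>
  then have nj: "?n - j \<ge> 1" using kr r j by linarith
  have "{..?n - j} = {0, 1} \<union> {2..?n - j}" using nj by auto
  then have "(\<Sum>i\<le>?n - j. ?f i) = (\<Sum>i\<in>{0, 1}. ?f i) + (\<Sum>i\<in>{2..?n - j}. ?f i)"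
    by (simp only:) (rule sum.union_disjoint, auto)
  then have "\<bar>(\<Sum>i\<le>?n - j. ?f i) - (?f 0 + ?f 1)\<bar> = \<bar>\<Sum>i\<in>{2..?n - j}. ?f i\<bar>"
    by simp
  also have "\<dots> \<le> (\<Sum>i\<in>{2..?n - j}. \<bar>coeff (U ^ j) i\<bar> * (1 / real r ^ (j + 2)))"
  proof (rule order_trans[OF sum_abs sum_mono])
    fix i assume i: "i \<in> {2..?n - j}"
    show "\<bar>?f i\<bar> \<le> \<bar>coeff (U ^ j) i\<bar> * (1 / real r ^ (j + 2))"
    proof (cases "coeff (U ^ j) i = 0")
      case False
      \<comment> \<open>A non-zero coefficient forces \<open>j + i \<le> (k - 1) * r\<close>, so all
        factors of the falling factorial are at least \<open>r\<close>.\<close>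
      then have "i \<le> degree (U ^ j)" by (rule le_degree)
      also have "\<dots> \<le> degree U * j" by (rule degree_power_le)
      also have "\<dots> \<le> (k - 2) * r" using U j by (rule mult_le_mono)
      finally have "j + i \<le> (k - 2) * r + r" using j by simp
      also have "\<dots> = (k - 1) * r" using k by (cases k) (auto simp: algebra_simps)
      finally have "r \<le> ?n - (j + i)" "j + i \<le> ?n" using kr by linarith+
      then have "inv_falling ?n (j + i) \<le> 1 / real r ^ (j + i)"
        using r by (intro inv_falling_le) auto
      also have "\<dots> \<le> 1 / real r ^ (j + 2)"
        using i r by (intro divide_left_mono power_increasing) auto
      finally show ?thesis
        by (simp only: abs_mult abs_of_nonneg[OF inv_falling_nonneg]) (intro mult_left_mono, auto)
    qed simp
  qed
  also have "\<dots> = (\<Sum>i\<in>{2..?n - j}. \<bar>coeff (U ^ j) i\<bar>) / real r ^ (j + 2)"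
    by (simp add: sum_divide_distrib)
  also have "\<dots> \<le> poly_l1 U ^ j / real r ^ (j + 2)"
  proof (rule divide_right_mono)
    have "(\<Sum>i\<in>{2..?n - j}. \<bar>coeff (U ^ j) i\<bar>) \<le> (\<Sum>i\<le>max (?n - j) (degree (U ^ j)). \<bar>coeff (U ^ j) i\<bar>)"
      by (rule sum_mono2) auto
    also have "\<dots> = poly_l1 (U ^ j)" by (rule poly_l1_bound[symmetric]) simp
    also have "\<dots> \<le> poly_l1 U ^ j" by (rule poly_l1_power)
    finally show "(\<Sum>i\<in>{2..?n - j}. \<bar>coeff (U ^ j) i\<bar>) \<le> poly_l1 U ^ j" .
  qed simp
  finally show ?thesis by simp
qed

lemma coeff_0_power: "coeff (U ^ j) 0 = coeff U 0 ^ j"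
  by (induction j) (simp_all add: coeff_mult_0)

lemma coeff_1_power:
  fixes U :: "'a :: comm_ring_1 poly"
  shows "coeff (U ^ j) 1 = of_nat j * coeff U 0 ^ (j - 1) * coeff U 1"
proof (induction j)
  case (Suc j)
  have "coeff (U ^ Suc j) 1 = coeff U 0 * coeff (U ^ j) 1 + coeff U 1 * coeff U 0 ^ j"
    by (simp add: coeff_mult coeff_0_power)
  then show ?case unfolding Suc.IH by (cases j) (simp_all add: algebra_simps)
qed simp

subsection \<open>Asymptotics of the terms\<close>

lemma inv_falling_Suc:
  assumes "d < n"
  shows "inv_falling n (Suc d) = inv_falling n d / (real n - real d)"
proof -
  have "n - d = Suc (n - Suc d)" using assms by simp
  then have "fact (n - d) = (real n - real d) * fact (n - Suc d)"
    using assms by (metis fact_Suc less_imp_le of_nat_diff)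
  then show ?thesis using assms by (simp add: inv_falling_def)
qed

text \<open>For \<open>j \<le> r\<close> this is the product over i < j of k (r - i) / (k r - i),
  which tends to 1 for fixed \<open>j\<close>; for \<open>j > r\<close> it is 0.\<close>

definition falling_ratio :: "nat \<Rightarrow> nat \<Rightarrow> nat \<Rightarrow> real" where
  "falling_ratio k r j = real k ^ j * fact j * real (r choose j) * inv_falling (k * r) j"

lemma Suc_times_choose_Suc:
  assumes "j \<le> r"
  shows "real (Suc j) * real (r choose Suc j) = (real r - real j) * real (r choose j)"
proof -
  have "Suc j * (r choose Suc j) = (r - j) * (r choose j)"
    by (simp only: binomial_absorption binomial_absorb_comp)
  then have "real (Suc j * (r choose Suc j)) = real ((r - j) * (r choose j))" by (rule arg_cong)
  then show ?thesis by (simp only: of_nat_mult of_nat_diff[OF assms])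
qed

lemma falling_ratio_Suc:
  assumes k: "k \<ge> 2" and r: "r \<ge> 1" and j: "j \<le> r"
  shows "falling_ratio k r (Suc j)
       = falling_ratio k r j * (1 - real j * (real k - 1) / (real k * real r - real j))"
proof -
  have "1 * r < k * r" using k r by (intro mult_strict_right_mono) auto
  then have jn: "j < k * r" using j by linarith
  then have "real j < real (k * r)" by (simp only: of_nat_less_iff)
  then have D: "real k * real r - real j > 0" by simp
  have "falling_ratio k r (Suc j) = real k ^ j * fact j * (real (Suc j) * real (r choose Suc j))
      * inv_falling (k * r) j * (real k / (real k * real r - real j))"
    using inv_falling_Suc[OF jn] by (simp add: falling_ratio_def del: binomial_Suc_Suc)
  also have "\<dots> = falling_ratio k r j * ((real r - real j) * (real k / (real k * real r - real j)))"
    unfolding Suc_times_choose_Suc[OF j] falling_ratio_def by (simp add: mult_ac)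
  also have "(real r - real j) * (real k / (real k * real r - real j))
      = 1 - real j * (real k - 1) / (real k * real r - real j)"
    using D by (simp add: field_simps)
  finally show ?thesis .
qed

text \<open>
  Every factor of the ratio differs from \<open>1\<close> by \<open>(1 - 1/k) j/r + O(j\<^sup>2/r\<^sup>2)\<close>, which gives the expansion by
  induction for \<open>j \<le> r\<close>. For \<open>j > r\<close> it stays true because the ratio vanishes and \<open>j/r > 1\<close>.
\<close>

lemma falling_ratio_bounds:
  assumes k: "k \<ge> 2" and r: "r \<ge> 1" and j: "j \<le> r"
  shows "0 \<le> falling_ratio k r j \<and> falling_ratio k r j \<le> 1 \<and>
         1 - falling_ratio k r j \<le> real j ^ 2 / real r \<and>
         \<bar>falling_ratio k r j - (1 - (real k - 1) / (2 * real k * real r) * (real j * (real j - 1)))\<bar>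
           \<le> real j ^ 4 / real r ^ 2"
  using j
proof (induction j)
  case 0
  then show ?case by (simp add: falling_ratio_def inv_falling_def)
next
  case (Suc j)
  define D where "D = real k * real r - real j"
  \<comment> \<open>The next factor of the ratio is \<open>1 - e\<close>, and
    \<open>b * real j\<close> is the first-order part of \<open>e\<close>.\<close>
  define e where "e = real j * (real k - 1) / D"
  define g where "g = falling_ratio k r j"
  define b where "b = (real k - 1) / (real k * real r)"
  have jr: "real j \<le> real r" and r0: "real r > 0" and k2: "real k \<ge> 2" using Suc.prems r k by auto
  have D: "D \<ge> (real k - 1) * real r" "D > 0"
  proof -
    show "D \<ge> (real k - 1) * real r" using jr by (simp add: D_def algebra_simps)
    moreover have "(real k - 1) * real r > 0" using k2 r0 by simp
    ultimately show "D > 0" by linarith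
  qed
  have e0: "e \<ge> 0" using k2 D(2) by (simp add: e_def)
  have "e \<le> real j * (real k - 1) / ((real k - 1) * real r)"
    unfolding e_def using D k2 r0 by (intro divide_left_mono) auto
  also have "\<dots> = real j / real r" using k2 by simp
  finally have e1: "e \<le> real j / real r" .
  then have e2: "e \<le> 1" using jr r0 by (smt (verit) divide_le_eq_1_pos)
  have "e - b * real j = e * (real j / (real k * real r))"
  proof -
    have "real k * real r = D + real j" by (simp add: D_def)
    then show ?thesis using D(2) k2 r0 unfolding b_def e_def
      by (simp add: divide_simps) (simp add: algebra_simps)
  qed
  moreover have "real j / (real k * real r) \<le> real j / real r"
    using k2 r0 by (intro divide_left_mono) auto
  moreover have "0 \<le> real j / (real k * real r)" by simp
  ultimately have e3: "\<bar>e - b * real j\<bar> \<le> real j / real r * (real j / real r)"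
    using mult_mono[OF e1, of "real j / (real k * real r)" "real j / real r"] e0 r0 by simp
  have IH: "0 \<le> g" "g \<le> 1" "1 - g \<le> real j ^ 2 / real r"
    "\<bar>g - (1 - (real k - 1) / (2 * real k * real r) * (real j * (real j - 1)))\<bar> \<le> real j ^ 4 / real r ^ 2"
    using Suc by (auto simp: g_def)
  have Sg: "falling_ratio k r (Suc j) = g * (1 - e)"
    using falling_ratio_Suc[OF k r] Suc.prems by (simp add: g_def e_def D_def)
  have 1: "0 \<le> g * (1 - e)" using IH e2 by simp
  have 2: "g * (1 - e) \<le> 1" using IH e0 e2 mult_mono[of g 1 "1 - e" 1] by simp
  have "1 - g * (1 - e) = (1 - g) + g * e" by (simp add: algebra_simps)
  also have "\<dots> \<le> real j ^ 2 / real r + 1 * (real j / real r)"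
    using IH e1 e0 by (intro add_mono mult_mono) auto
  also have "\<dots> \<le> real (Suc j) ^ 2 / real r"
    using r0 by (simp add: divide_simps power2_eq_square algebra_simps)
  finally have 3: "1 - g * (1 - e) \<le> real (Suc j) ^ 2 / real r" .
  have b: "(real k - 1) / (2 * real k * real r) = b / 2" by (simp add: b_def)
  \<comment> \<open>The new error is the old error, minus the first-order error of \<open>e\<close>,
    plus a cross term; the quadratic term grows by exactly \<open>b * real j\<close>.\<close>
  have "g * (1 - e) - (1 - b / 2 * (real (Suc j) * (real (Suc j) - 1)))
      = (g - (1 - b / 2 * (real j * (real j - 1)))) - (e - b * real j) + e * (1 - g)"
    by (simp add: field_simps)
  also have "\<bar>\<dots>\<bar> \<le> real j ^ 4 / real r ^ 2 + real j / real r * (real j / real r) + real j / real r * (real j ^ 2 / real r)"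
  proof -
    have "\<bar>e * (1 - g)\<bar> \<le> real j / real r * (real j ^ 2 / real r)"
      using mult_mono[OF e1 IH(3)] IH(2) e0 r0 by simp
    then show ?thesis using IH(4) e3 unfolding b by linarith
  qed
  also have "\<dots> = (real j ^ 4 + real j ^ 2 + real j ^ 3) / real r ^ 2"
    using r0 by (simp add: field_simps power2_eq_square power3_eq_cube)
  also have "\<dots> \<le> real (Suc j) ^ 4 / real r ^ 2"
  \<comment> \<open>The increments of orders two and three in \<open>j\<close> fit into the
    expansion of (j + 1)^4, which is why a fourth power is used as error bound.\<close>
  proof (rule divide_right_mono)
    have "real (Suc j) ^ 4 = real j ^ 4 + 4 * real j ^ 3 + 6 * real j ^ 2 + 4 * real j + 1"
      by (simp add: power_numeral_reduce algebra_simps)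
    moreover have "real j ^ 2 \<ge> 0" "real j ^ 3 \<ge> 0" by simp_all
    ultimately show "real j ^ 4 + real j ^ 2 + real j ^ 3 \<le> real (Suc j) ^ 4" by linarith
  qed simp
  finally show ?case unfolding Sg b using 1 2 3 by simp
qed

lemma falling_ratio_expansion:
  assumes k: "k \<ge> 2" and r: "r \<ge> 1"
  shows "\<bar>falling_ratio k r j - (1 - (real k - 1) / (2 * real k * real r) * (real j * (real j - 1)))\<bar>
           \<le> real j ^ 4 / real r ^ 2"
proof (cases "j \<le> r")
  case True
  then show ?thesis using falling_ratio_bounds[OF k r] by simp
next
  case False
  define x where "x = (real k - 1) / (2 * real k * real r) * (real j * (real j - 1))"
  have jr: "real j \<ge> real r" "real r \<ge> 1" using False r by auto
  have g: "falling_ratio k r j = 0" using False by (simp add: falling_ratio_def)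
  have "1 \<le> (real j / real r) ^ 4" using jr by (intro one_le_power) simp
  also have "\<dots> \<le> real j ^ 4 / real r ^ 2"
    using jr by (simp add: power_divide) (intro divide_left_mono power_increasing, auto)
  finally have 1: "1 \<le> real j ^ 4 / real r ^ 2" .
  have x0: "x \<ge> 0" using k jr by (simp add: x_def)
  have "(real k - 1) / (2 * real k * real r) \<le> 1 / real r"
    using k jr by (simp add: divide_simps)
  then have "x \<le> 1 / real r * (real j * real j)"
    unfolding x_def using jr by (intro mult_mono) auto
  also have "\<dots> = (real j * real j) * real r / real r ^ 2"
    using jr by (simp add: power2_eq_square)
  also have "\<dots> \<le> real j ^ 4 / real r ^ 2"
  proof (rule divide_right_mono)
    have "real r \<le> real j * real j" using jr mult_mono[of 1 "real j" "real r" "real j"] by simp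
    then show "(real j * real j) * real r \<le> real j ^ 4"
      using mult_left_mono[of "real r" "real j * real j" "real j * real j"]
      by (simp add: power_numeral_reduce mult_ac)
  qed simp
  finally have "x \<le> real j ^ 4 / real r ^ 2" .
  then show ?thesis unfolding g x_def[symmetric] using 1 x0 by linarith
qed

text \<open>For \<open>j \<le> r\<close> the quantity is the falling ratio divided by k r - j.
  Replacing the ratio by 1 and then the denominator by k r costs one summand each. First order
  suffices, since this quantity is already of size 1/r. For \<open>j > r\<close> the binomial
  vanishes and 1/(k r) is at most (j/r)^2.\<close>

lemma shifted_falling_ratio_expansion:
  assumes k: "k \<ge> 2" and r: "r \<ge> 1"
  shows "\<bar>real k ^ j * fact j * real (r choose j) * inv_falling (k * r) (Suc j) - 1 / (real k * real r)\<bar>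
           \<le> 2 * real j ^ 2 / real r ^ 2"
proof (cases "j \<le> r")
  case True
  define D where "D = real k * real r - real j"
  define g where "g = falling_ratio k r j"
  have jr: "real j \<le> real r" and r0: "real r > 0" and k2: "real k \<ge> 2" using True r k by auto
  have "2 * real r \<le> real k * real r" using k2 by (intro mult_right_mono) auto
  then have D: "D \<ge> real r" using jr by (simp add: D_def)
  have "1 * r < k * r" using k r by (intro mult_strict_right_mono) auto
  then have jn: "j < k * r" using True by linarith
  have *: "real k ^ j * fact j * real (r choose j) * inv_falling (k * r) (Suc j) = g / D"
    unfolding inv_falling_Suc[OF jn] by (simp add: g_def falling_ratio_def D_def)
  have "real k * real r = D + real j" by (simp add: D_def)
  then have "g / D - 1 / (real k * real r) = (g - 1) / D + real j / (D * (real k * real r))"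
    using D r0 by (simp add: divide_simps) (simp add: algebra_simps)
  also have "\<bar>\<dots>\<bar> \<le> (real j ^ 2 / real r) / real r + real j / (real r * real r)"
  proof (rule order_trans[OF abs_triangle_ineq add_mono])
    have "0 \<le> 1 - g" "1 - g \<le> real j ^ 2 / real r"
      using falling_ratio_bounds[OF k r True] by (auto simp: g_def)
    then have "(1 - g) / D \<le> (real j ^ 2 / real r) / real r"
      using D r0 by (intro frac_le) auto
    moreover have "\<bar>(g - 1) / D\<bar> = (1 - g) / D"
      using \<open>0 \<le> 1 - g\<close> D r0 by simp
    ultimately show "\<bar>(g - 1) / D\<bar> \<le> (real j ^ 2 / real r) / real r" by simp
    have "real r \<le> real k * real r" using \<open>2 * real r \<le> real k * real r\<close> r0 by linarith
    then have "real r * real r \<le> D * (real k * real r)"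
      using D r0 by (intro mult_mono) auto
    then have "real j / (D * (real k * real r)) \<le> real j / (real r * real r)"
      using r0 by (intro frac_le) auto
    then show "\<bar>real j / (D * (real k * real r))\<bar> \<le> real j / (real r * real r)"
      using D r0 by simp
  qed
  also have "\<dots> = (real j ^ 2 + real j) / real r ^ 2"
    using r0 by (simp add: field_simps power2_eq_square)
  also have "\<dots> \<le> 2 * real j ^ 2 / real r ^ 2"
  proof (rule divide_right_mono)
    have "real j \<le> real j ^ 2" by (cases j) (auto simp: power2_eq_square)
    then show "real j ^ 2 + real j \<le> 2 * real j ^ 2" by simp
  qed simp
  finally show ?thesis unfolding * .
next
  case False
  have jr: "real j \<ge> real r" "real r \<ge> 1" "real k \<ge> 1" using False r k by auto
  have "1 / (real k * real r) \<le> 1"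
    using jr mult_mono[of 1 "real k" 1 "real r"] by simp
  also have "1 \<le> (real j / real r) ^ 2" using jr by (intro one_le_power) simp
  also have "\<dots> \<le> 2 * real j ^ 2 / real r ^ 2" by (simp add: power_divide divide_right_mono)
  finally have "\<bar>0 - 1 / (real k * real r)\<bar> \<le> 2 * real j ^ 2 / real r ^ 2" by simp
  then show ?thesis using False by (simp add: binomial_eq_0)
qed

text \<open>The first and second factorial moments of the exponential series are obtained by
  shifting the index once and twice.\<close>

lemma poisson_sums:
  fixes x p q :: real
  shows "(\<lambda>j. x ^ j / fact j * (1 - p * (real j * (real j - 1)) - q * real j))
           sums (exp x * (1 - p * x ^ 2 - q * x))"
proof -
  have 0: "(\<lambda>j. x ^ j / fact j) sums exp x"
    using exp_converges[of x] by (simp add: field_simps)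
  have 1: "(\<lambda>j. x ^ j / fact j * real j) sums (x * exp x)"
  proof (rule sums_Suc_imp)
    have "(\<lambda>j. x * (x ^ j / fact j)) sums (x * exp x)" by (rule sums_mult[OF 0])
    also have "(\<lambda>j. x * (x ^ j / fact j)) = (\<lambda>j. x ^ Suc j / fact (Suc j) * real (Suc j))"
      by (intro ext) (simp add: fact_Suc del: of_nat_Suc)
    finally show "(\<lambda>j. x ^ Suc j / fact (Suc j) * real (Suc j)) sums (x * exp x)" .
  qed simp
  have 2: "(\<lambda>j. x ^ j / fact j * (real j * (real j - 1))) sums (x * (x * exp x))"
  proof (rule sums_Suc_imp)
    have "(\<lambda>j. x * (x ^ j / fact j * real j)) sums (x * (x * exp x))" by (rule sums_mult[OF 1])
    also have "(\<lambda>j. x * (x ^ j / fact j * real j))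
        = (\<lambda>j. x ^ Suc j / fact (Suc j) * (real (Suc j) * (real (Suc j) - 1)))"
      by (intro ext) (simp add: fact_Suc del: of_nat_Suc)
    finally show "(\<lambda>j. x ^ Suc j / fact (Suc j) * (real (Suc j) * (real (Suc j) - 1))) sums (x * (x * exp x))" .
  qed simp
  show ?thesis
    using sums_diff[OF sums_diff[OF 0 sums_mult[OF 2, of p]] sums_mult[OF 1, of q]]
    by (simp add: algebra_simps add_divide_distrib power2_eq_square)
qed

subsection \<open>Asymptotics of the sum\<close>

lemma AO_asymptotics:
  fixes k :: nat
  assumes k: "k \<ge> 2"
  shows "\<exists>K. \<forall>r\<ge>1. \<bar>real (AO (complete_multipartite r (\<lambda>_. k))) / fact (k * r)
           - exp (- (real k - 1) / 2) * (1 - (real k - 1) * (5 * real k - 7) / (24 * real k * real r))\<bar>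
         \<le> K / real r ^ 2"
proof -
  obtain U where U: "reflect_poly (signed_touchard k) = pCons 1 U" "degree U \<le> k - 2"
    "coeff U 0 = - (real k * (real k - 1) / 2)"
    "coeff U 1 = real k * (real k - 1) * (real k - 2) * (3 * real k - 5) / 24"
    using reflect_signed_touchard[OF k] .
  \<comment> \<open>The low coefficients of \<open>U\<close> are -k c and \<gamma> k c. Hence the
    linear coefficient of each power \<open>U ^ j\<close> is \<open>- j * \<gamma>\<close> times its
    constant one.\<close>
  define c where "c = (real k - 1) / 2"
  define \<gamma> where "\<gamma> = (real k - 2) * (3 * real k - 5) / 12"
  define M where "M = poly_l1 U"
  \<comment> \<open>The first summand pays for the coefficients of index at least two, the second
    for the expansion of the others in 1/r; the 16 comes from bounding j^4 by 16^j.\<close>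
  define K where "K = exp M + (1 + 2 * \<gamma>) * exp (16 * c)"
  have c: "c \<ge> 0" and \<gamma>: "\<gamma> \<ge> 0" using k by (auto simp: c_def \<gamma>_def)
  have M: "M \<ge> 0" by (simp add: M_def poly_l1_nonneg)
  have U0: "coeff (U ^ j) 0 = real k ^ j * (- c) ^ j" for j
    by (simp add: coeff_0_power U(3) c_def flip: power_mult_distrib)
  have U1: "coeff (U ^ j) 1 = - (real j * \<gamma> * (real k ^ j * (- c) ^ j))" for j
  proof (cases j)
    case (Suc i)
    have "coeff U 1 = - \<gamma> * (real k * - c)"
      unfolding U(4) by (simp add: c_def \<gamma>_def field_simps)
    moreover have "coeff U 0 = real k * - c" by (simp add: U(3) c_def)
    ultimately show ?thesis
      unfolding coeff_1_power power_mult_distrib[symmetric] by (simp add: Suc mult_ac)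
  qed (simp add: coeff_1_power)
  have "\<bar>real (AO (complete_multipartite r (\<lambda>_. k))) / fact (k * r)
           - exp (- c) * (1 - (real k - 1) * (5 * real k - 7) / (24 * real k * real r))\<bar> \<le> K / real r ^ 2"
    if r: "r \<ge> 1" for r
  proof -
    define p where "p = (real k - 1) / (2 * real k * real r)"
    define q where "q = \<gamma> / (real k * real r)"
    define s where "s j = real k ^ j * fact j * real (r choose j) * inv_falling (k * r) (Suc j)" for j
    define T where "T j = (\<Sum>i\<le>k * r - j. coeff (U ^ j) i * inv_falling (k * r) (j + i))" for j
    \<comment> \<open>\<open>t j\<close> collects the contributions of the coefficients of index 0
      and 1, and \<open>a j\<close> is its expansion up to order 1/r.\<close>
    define t where "t j = (- c) ^ j / fact j * (falling_ratio k r j - \<gamma> * real j * s j)" for j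
    define a where "a j = (- c) ^ j / fact j * (1 - p * (real j * (real j - 1)) - q * real j)" for j
    have AO: "real (AO (complete_multipartite r (\<lambda>_. k))) / fact (k * r)
        = (\<Sum>j\<le>r. real (r choose j) * T j)"
      unfolding AO_complete_multipartite T_def using k
      by (intro factorial_functional_power U(1) degree_signed_touchard) simp

    have main: "real (r choose j) * (coeff (U ^ j) 0 * inv_falling (k * r) j
        + coeff (U ^ j) 1 * inv_falling (k * r) (Suc j)) = t j" for j
      by (simp add: U0 U1[unfolded One_nat_def] t_def s_def falling_ratio_def field_simps)
    have "\<bar>(\<Sum>j\<le>r. real (r choose j) * T j) - (\<Sum>j\<le>r. t j)\<bar>
        \<le> (\<Sum>j\<le>r. M ^ j / fact j / real r ^ 2)"
      unfolding sum_subtractf[symmetric]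
    proof (rule order_trans[OF sum_abs sum_mono])
      fix j assume "j \<in> {..r}"
      then have "\<bar>T j - (coeff (U ^ j) 0 * inv_falling (k * r) j + coeff (U ^ j) 1 * inv_falling (k * r) (Suc j))\<bar>
          \<le> M ^ j / real r ^ (j + 2)"
        unfolding T_def M_def by (intro higher_coefficients_bound U(2) k r) simp
      then have "\<bar>real (r choose j) * T j - t j\<bar> \<le> real (r choose j) * (M ^ j / real r ^ (j + 2))"
        unfolding main[symmetric] right_diff_distrib[symmetric] abs_mult abs_of_nat
        by (rule mult_left_mono) simp
      also have "\<dots> \<le> real r ^ j / fact j * (M ^ j / real r ^ (j + 2))"
        using M by (intro mult_right_mono binomial_le_pow_div_fact) auto
      also have "\<dots> = M ^ j / fact j / real r ^ 2"
        using r by (simp add: power_add power2_eq_square)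
      finally show "\<bar>real (r choose j) * T j - t j\<bar> \<le> M ^ j / fact j / real r ^ 2" .
    qed
    also have "\<dots> \<le> exp M / real r ^ 2"
      unfolding sum_divide_distrib[symmetric]
      by (rule divide_right_mono[OF sum_power_div_fact_le_exp[OF M]]) simp
    finally have 1: "\<bar>(\<Sum>j\<le>r. real (r choose j) * T j) - (\<Sum>j\<le>r. t j)\<bar> \<le> exp M / real r ^ 2" .

    \<comment> \<open>The terms beyond \<open>r\<close> vanish with the binomial coefficient, so the
      finite sum is a full series and can be compared with the exponential series term by
      term.\<close>
    have "t sums (\<Sum>j\<le>r. t j)"
      by (rule sums_finite) (auto simp: t_def s_def falling_ratio_def binomial_eq_0)
    moreover have "a sums (exp (- c) * (1 - p * (- c) ^ 2 - q * (- c)))"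
      unfolding a_def by (rule poisson_sums)
    ultimately have "(\<lambda>j. t j - a j) sums ((\<Sum>j\<le>r. t j) - exp (- c) * (1 - p * (- c) ^ 2 - q * (- c)))"
      by (rule sums_diff)
    moreover have "(\<lambda>j. (1 + 2 * \<gamma>) / real r ^ 2 * ((16 * c) ^ j / fact j)) sums ((1 + 2 * \<gamma>) / real r ^ 2 * exp (16 * c))"
      using exp_converges[of "16 * c"] by (intro sums_mult) (simp add: field_simps)
    moreover have "norm (t j - a j) \<le> (1 + 2 * \<gamma>) / real r ^ 2 * ((16 * c) ^ j / fact j)" for j
    proof -
      have g: "\<bar>falling_ratio k r j - (1 - p * (real j * (real j - 1)))\<bar> \<le> real j ^ 4 / real r ^ 2"
        unfolding p_def by (rule falling_ratio_expansion[OF k r])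
      have s: "\<bar>s j - 1 / (real k * real r)\<bar> \<le> 2 * real j ^ 2 / real r ^ 2"
        unfolding s_def by (rule shifted_falling_ratio_expansion[OF k r])
      \<comment> \<open>A geometric bound lets the error terms be dominated by an exponential
        series.\<close>
      have j4: "real j ^ 4 \<le> 16 ^ j"
      proof -
        have "real j \<le> 2 ^ j" using of_nat_less_two_power[of j] by (simp add: less_imp_le)
        then have "real j ^ 4 \<le> (2 ^ j) ^ 4" by (rule power_mono) simp
        also have "\<dots> = (2 ^ 4) ^ j" by (metis power_mult mult.commute)
        also have "\<dots> = 16 ^ j" by simp
        finally show ?thesis .
      qed
      have "t j - a j = (- c) ^ j / fact j * ((falling_ratio k r j - (1 - p * (real j * (real j - 1))))
          - \<gamma> * real j * (s j - 1 / (real k * real r)))"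
        by (simp add: t_def a_def q_def algebra_simps add_divide_distrib)
      also have "norm \<dots> = c ^ j / fact j * \<bar>(falling_ratio k r j - (1 - p * (real j * (real j - 1))))
          - \<gamma> * real j * (s j - 1 / (real k * real r))\<bar>"
        using c by (simp add: abs_mult power_abs)
      also have "\<dots> \<le> c ^ j / fact j * ((1 + 2 * \<gamma>) / real r ^ 2 * 16 ^ j)"
      proof (rule mult_left_mono)
        have "\<bar>\<gamma> * real j * (s j - 1 / (real k * real r))\<bar> \<le> \<gamma> * real j * (2 * real j ^ 2 / real r ^ 2)"
          using \<gamma> mult_left_mono[OF s, of "\<gamma> * real j"] by (simp add: abs_mult)
        also have "\<dots> = 2 * \<gamma> / real r ^ 2 * real j ^ 3"
          by (simp add: power2_eq_square power3_eq_cube)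
        also have "\<dots> \<le> 2 * \<gamma> / real r ^ 2 * real j ^ 4"
        proof (rule mult_left_mono)
          show "real j ^ 3 \<le> real j ^ 4" by (cases "j = 0") (auto intro: power_increasing)
        qed (use \<gamma> in simp)
        finally have "\<bar>(falling_ratio k r j - (1 - p * (real j * (real j - 1))))
            - \<gamma> * real j * (s j - 1 / (real k * real r))\<bar>
            \<le> real j ^ 4 / real r ^ 2 + 2 * \<gamma> / real r ^ 2 * real j ^ 4"
          using g by linarith
        also have "\<dots> = (1 + 2 * \<gamma>) / real r ^ 2 * real j ^ 4"
          by (simp add: add_divide_distrib algebra_simps)
        also have "\<dots> \<le> (1 + 2 * \<gamma>) / real r ^ 2 * 16 ^ j"
          using \<gamma> j4 by (intro mult_left_mono) auto
        finally show "\<bar>(falling_ratio k r j - (1 - p * (real j * (real j - 1))))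
            - \<gamma> * real j * (s j - 1 / (real k * real r))\<bar> \<le> (1 + 2 * \<gamma>) / real r ^ 2 * 16 ^ j" .
      qed (use c in simp)
      also have "\<dots> = (1 + 2 * \<gamma>) / real r ^ 2 * ((16 * c) ^ j / fact j)"
        by (simp add: power_mult_distrib mult_ac)
      finally show ?thesis .
    qed
    ultimately have "norm ((\<Sum>j\<le>r. t j) - exp (- c) * (1 - p * (- c) ^ 2 - q * (- c)))
        \<le> (1 + 2 * \<gamma>) / real r ^ 2 * exp (16 * c)"
      by (rule norm_sums_le)
    \<comment> \<open>The quadratic terms cancel: 3 (k-1)^2 - (k-2)(3k-5) = 5k - 7.\<close>
    moreover have "1 - p * (- c) ^ 2 - q * (- c)
        = 1 - (real k - 1) * (5 * real k - 7) / (24 * real k * real r)"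
      using k r by (simp add: p_def q_def c_def \<gamma>_def divide_simps power2_eq_square)
        (simp add: algebra_simps)
    moreover have "K / real r ^ 2 = exp M / real r ^ 2 + (1 + 2 * \<gamma>) / real r ^ 2 * exp (16 * c)"
      by (simp add: K_def add_divide_distrib[of "exp M"])
    ultimately show ?thesis
      using 1 unfolding AO by (simp only: real_norm_def)
  qed
  moreover have "- (real k - 1) / 2 = - c" by (simp add: c_def field_simps)
  ultimately show ?thesis by (simp only:) blast
qed

theorem theorem6:
  fixes k :: nat
  assumes "k \<ge> 1"
  shows "\<exists>err :: nat \<Rightarrow> real.
           err \<in> O(\<lambda>r. 1 / real r ^ 2) \<and>
           (\<forall>r\<ge>1. real (AO (complete_multipartite r (\<lambda>_. k))) =
              exp (- (real k - 1) / 2) * fact (k * r) *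
              (1 - (real k - 1) * (5 * real k - 7) / (24 * real k * real r) + err r))"
proof -
  define A where "A r = real (AO (complete_multipartite r (\<lambda>_. k))) / fact (k * r)" for r
  define E where "E = exp (- (real k - 1) / 2)"
  define h where "h r = 1 - (real k - 1) * (5 * real k - 7) / (24 * real k * real r)" for r
  obtain K where K: "\<bar>A r - E * h r\<bar> \<le> K / real r ^ 2" if "r \<ge> 1" for r
  proof (cases "k = 1")
    \<comment> \<open>For \<open>k = 1\<close> the polynomial is t and the count is exactly r!, so
      the error constant is 0.\<close>
    case True
    have "signed_touchard 1 ^ r = monom 1 r" for r by (simp add: one_pCons monom_altdef)
    then have "A r = 1" for r
      unfolding A_def AO_complete_multipartite True
      by (simp add: factorial_functional_def degree_monom_eq if_distrib[of "\<lambda>x. x * _"] cong: if_cong)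
    then show ?thesis using that[of 0] by (simp add: E_def h_def True)
  next
    case False
    then have "k \<ge> 2" using assms by simp
    from AO_asymptotics[OF this] show ?thesis using that unfolding A_def E_def h_def by blast
  qed
  have E: "E > 0" by (simp add: E_def)
  show ?thesis
  \<comment> \<open>Solving the claimed equation for the error dictates the witness; dividing by the
    positive constant \<open>E\<close> preserves the order of the bound.\<close>
  proof (intro exI[of _ "\<lambda>r. A r / E - h r"] conjI allI impI)
    show "(\<lambda>r. A r / E - h r) \<in> O(\<lambda>r. 1 / real r ^ 2)"
    proof (rule bigoI[of _ "K / E"], rule eventually_mono[OF eventually_ge_at_top[of 1]])
      fix r :: nat assume r: "r \<ge> 1"
      have "A r / E - h r = (A r - E * h r) / E" using E by (simp add: diff_divide_distrib)
      then have "norm (A r / E - h r) = \<bar>A r - E * h r\<bar> / E" using E by simp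
      also have "\<dots> \<le> K / real r ^ 2 / E" using K[OF r] E by (intro divide_right_mono) auto
      finally show "norm (A r / E - h r) \<le> K / E * norm (1 / real r ^ 2)" by (simp add: mult.commute)
    qed
    show "real (AO (complete_multipartite r (\<lambda>_. k))) = exp (- (real k - 1) / 2) * fact (k * r) *
        (1 - (real k - 1) * (5 * real k - 7) / (24 * real k * real r) + (A r / E - h r))" for r
      using E unfolding h_def[symmetric] E_def[symmetric] by (simp add: A_def)
  qed
qed

end
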